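(* Let $T\ge 2$, and let $\widetilde{\mathcal{U}}_1$, $\widetilde{\mathcal{U}}_t(\mathbf{d}_{t-1})$ ($t=2,\dots,T$) be the moment-based connected ambiguity sets of the context, with $\boldsymbol{\mu}_t(\mathbf{d}_{t-1})=\mathbf{A}_t\mathbf{d}_{t-1}+\mathbf{b}_t$ for $t\ge2$. Fix decisions $\mathbf{x}_1,\dots,\mathbf{x}_T$ and $B\in\mathbb{R}$. Suppose there exist $p_t\in\mathbb{R}$, $\mathbf{q}^u_t,\mathbf{q}^l_t\in\mathbb{R}^m$ and symmetric matrices $\mathbf{R}_t\in\mathbb{R}^{m\times m}$, $t=1,\dots,T$, such that $$p_1+(\mathbf{q}^u_1-\mathbf{q}^l_1)^\top\boldsymbol{\mu}_1+(\mathbf{q}^u_1+\mathbf{q}^l_1)^\top\boldsymbol{\delta}_1+\mathbf{R}_1\cdot\mathbf{M}_1\le B,$$ $$\alpha_t+\boldsymbol{\beta}_t^\top\mathbf{d}_t+\mathbf{d}_t^\top\mathbf{R}_t\mathbf{d}_t-h_t(\mathbf{x}_t,\mathbf{d}_t)\ge0\quad\forall\mathbf{d}_t\in\Xi_t,\ \forall t=1,\dots,T-1,$$ $$p_T+(\mathbf{q}^u_T-\mathbf{q}^l_T-2\mathbf{R}_T\boldsymbol{\mu}^0_T)^\top\mathbf{d}_T+\mathbf{d}_T^\top\mathbf{R}_T\mathbf{d}_T\ge h_T(\mathbf{x}_T,\mathbf{d}_T)\quad\forall\mathbf{d}_T\in\Xi_T,$$ $$\mathbf{q}^u_t,\mathbf{q}^l_t\ge0,\quad\mathbf{R}_t\succeq0\quad\forall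 t=1,\dots,T,$$ where, for $i=1,\dots,T-1$, $$\alpha_i=p_i-p_{i+1}-(\mathbf{q}^u_{i+1}-\mathbf{q}^l_{i+1})^\top\mathbf{b}_{i+1}-\mathbf{R}_{i+1}\cdot\mathbf{M}_{i+1}-(\mathbf{q}^u_{i+1}+\mathbf{q}^l_{i+1})^\top\boldsymbol{\delta}_{i+1},$$ $$\boldsymbol{\beta}_i=\mathbf{q}^u_i-\mathbf{q}^l_i-2\mathbf{R}_i\boldsymbol{\mu}^0_i-\mathbf{A}_{i+1}^\top\mathbf{q}^u_{i+1}+\mathbf{A}_{i+1}^\top\mathbf{q}^l_{i+1}.$$ Then the distributionally robust constraint $$\sup_{P_1\in\widetilde{\mathcal{U}}_1}\mathbb{E}_{P_1}\Big[h_1(\mathbf{x}_1,\mathbf{d}_1)+\sup_{P_{2|1}\in\widetilde{\mathcal{U}}_2(\mathbf{d}_1)}\mathbb{E}_{P_{2|1}}\big[h_2(\mathbf{x}_2,\mathbf{d}_2)+\dots+\sup_{P_{T|T-1}\in\widetilde{\mathcal{U}}_T(\mathbf{d}_{T-1})}\mathbb{E}_{P_{T|T-1}}[h_T(\mathbf{x}_T,\mathbf{d}_T)]\big]\Big]\le B$$ holds; that is, the system in the variables $\mathbf{x}_t,p_t,\mathbf{q}^u_t,\mathbf{q}^l_t,\mathbf{R}_t$ ($t=1,\dots,T$) consisting of the inequality $p_1+(\mathbf{q}^u_1-\mathbf{q}^l_1)^\top\boldsymbol{\mu}_1+(\mathbf{q}^u_1+\mathbf{q}^l_1)^\top\boldsymbol{\delta}_1+\mathbf{R}_1\cdot\mathbf{M}_1\le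 B$, the constraints $\alpha_t+\boldsymbol{\beta}_t^\top\mathbf{d}_t+\mathbf{d}_t^\top\mathbf{R}_t\mathbf{d}_t-h_t(\mathbf{x}_t,\mathbf{d}_t)\ge0$ for all $\mathbf{d}_t\in\Xi_t$ and $t=1,\dots,T-1$, the constraint $p_T+(\mathbf{q}^u_T-\mathbf{q}^l_T-2\mathbf{R}_T\boldsymbol{\mu}^0_T)^\top\mathbf{d}_T+\mathbf{d}_T^\top\mathbf{R}_T\mathbf{d}_T\ge h_T(\mathbf{x}_T,\mathbf{d}_T)$ for all $\mathbf{d}_T\in\Xi_T$, and the conditions $\mathbf{q}^u_t,\mathbf{q}^l_t\ge0$, $\mathbf{R}_t\succeq0$ for all $t=1,\dots,T$, is a conservative reformulation of this distributionally robust constraint.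
   Context: $\mathbf{d}_t\in\mathbb{R}^m$ is the uncertain parameter of period $t$ with given support set $\Xi_t\subseteq\mathbb{R}^m$; decisions $\mathbf{x}_t\in\mathbb{R}^{n_t}$ are here-and-now (do not depend on the uncertainty). The functions $h_t(\mathbf{x}_t,\mathbf{d}_t)$ are real valued, with no structure assumed beyond the regularity required for the integrals involved to exist. $\mathcal{M}$ is the set of nonnegative Borel measures on $\mathbb{R}^m$. The ambiguity sets are, for $t\ge2$, $$\widetilde{\mathcal{U}}_t(\mathbf{d}_{t-1})=\big\{P\in\mathcal{M}\ \big|\ P(\mathbf{d}_t\in\Xi_t)=1,\ |\mathbb{E}_P[\mathbf{d}_t]-\boldsymbol{\mu}_t(\mathbf{d}_{t-1})|\le\boldsymbol{\delta}_t,\ \mathbb{E}_P[(\mathbf{d}_t-\boldsymbol{\mu}^0_t)(\mathbf{d}_t-\boldsymbol{\mu}^0_t)^\top]\preceq\boldsymbol{\Sigma}_t\big\}$$ (distributions $P=P_{t|t-1}$ of $\mathbf{d}_t$ conditional on $\mathbf{d}_{t-1}$), and $\widetilde{\mathcal{U}}_1$ is defined in the same way with a constant vector $\boldsymbol{\mu}_1$ in place of $\boldsymbol{\mu}_t(\mathbf{d}_{t-1})$. Absolute values and vector inequalities are componentwise; $\preceq$ is the positive semidefinite order. $\boldsymbol{\mu}^0_t\in\mathbb{R}^m$ (a constant mean estimate), $\boldsymbol{\delta}_t\in\mathbb{R}^m$, $\boldsymbol{\Sigma}_t\in\mathbb{R}^{m\times m}$, $\mathbf{A}_t\in\mathbb{R}^{m\times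 m}$, $\mathbf{b}_t\in\mathbb{R}^m$ are constants. $\mathbf{M}_t=\boldsymbol{\Sigma}_t-\boldsymbol{\mu}^0_t(\boldsymbol{\mu}^0_t)^\top$, and $\mathbf{R}\cdot\mathbf{M}=\operatorname{tr}(\mathbf{R}^\top\mathbf{M})$ is the Frobenius inner product. "Conservative reformulation" means that feasibility for the reformulation implies feasibility for the original constraint. *)

theory Defs
  imports "HOL-Probability.Probability"
begin

definition outer_prod :: "real^'m \<Rightarrow> real^'n \<Rightarrow> real^'n^'m" where
  "outer_prod v w = (columnvector v :: real^1^'m) ** (rowvector w :: real^'n^1)"

definition frobenius_inner :: "real^'n^'m \<Rightarrow> real^'n^'m \<Rightarrow> real" where
  "frobenius_inner R M = trace (transpose R ** M)"

definition psd :: "real^'m^'m \<Rightarrow> bool" where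
  "psd A \<longleftrightarrow> transpose A = A \<and> (\<forall>v. 0 \<le> v \<bullet> (A *v v))"

definition psd_le :: "real^'m^'m \<Rightarrow> real^'m^'m \<Rightarrow> bool" (infix "\<preceq>\<^sub>p\<^sub>s\<^sub>d" 50) where
  "A \<preceq>\<^sub>p\<^sub>s\<^sub>d B \<longleftrightarrow> psd (B - A)"

text \<open>
  Expectations of extended real functions.  The truncation in \<^const>\<open>e2ennreal\<close> yields the positive
  and negative parts.  The value is meaningful when \<open>expectation_exists P f\<close> holds; measurability
  is only required with respect to the completion of \<open>P\<close>, as the worst-case values below are
  suprema over uncountable families of measures.
\<close>

definition eexpectation :: "'a measure \<Rightarrow> ('a \<Rightarrow> ereal) \<Rightarrow> ereal" where
  "eexpectation P f =
     enn2ereal (\<integral>\<^sup>+ d. e2ennreal (f d) \<partial>P) - enn2ereal (\<integral>\<^sup>+ d. e2ennreal (- f d) \<partial>P)"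

definition expectation_exists :: "'a measure \<Rightarrow> ('a \<Rightarrow> ereal) \<Rightarrow> bool" where
  "expectation_exists P f \<longleftrightarrow>
     f \<in> borel_measurable (completion P) \<and>
     ((\<integral>\<^sup>+ d. e2ennreal (f d) \<partial>P) < \<infinity> \<or> (\<integral>\<^sup>+ d. e2ennreal (- f d) \<partial>P) < \<infinity>)"

text \<open>
  The members are probability distributions on the whole space, not arbitrary nonnegative measures
  giving mass one to the support set.  Both moments are required to exist, since the Bochner
  integral of a non-integrable function is zero by convention.  Order and absolute value on
  vectors are componentwise.
\<close>

definition ambiguity_set ::
  "(real^'m) set \<Rightarrow> real^'m \<Rightarrow> real^'m \<Rightarrow> real^'m \<Rightarrow> real^'m^'m \<Rightarrow> (real^'m) measure set" where
  "ambiguity_set \<Xi> \<mu> \<delta> \<mu>\<^sub>0 \<Sigma> =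
     {P. sets P = sets borel \<and> prob_space P \<and> emeasure P \<Xi> = 1 \<and>
         integrable P (\<lambda>d. d) \<and>
         integrable P (\<lambda>d. outer_prod (d - \<mu>\<^sub>0) (d - \<mu>\<^sub>0)) \<and>
         \<bar>(\<integral>d. d \<partial>P) - \<mu>\<bar> \<le> \<delta> \<and>
         (\<integral>d. outer_prod (d - \<mu>\<^sub>0) (d - \<mu>\<^sub>0) \<partial>P) \<preceq>\<^sub>p\<^sub>s\<^sub>d \<Sigma>}"

text \<open>
  \<open>worst_case_from \<U> g T t d\<close> is the nested worst-case expectation of the costs \<open>g\<close> of the periods
  \<open>t, \<dots>, T\<close>, given the realization \<open>d\<close> of period \<open>t - 1\<close>.  A supremum over an empty ambiguity
  set is \<open>-\<infinity>\<close>.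
\<close>

function worst_case_from ::
  "(nat \<Rightarrow> 'a \<Rightarrow> 'a measure set) \<Rightarrow> (nat \<Rightarrow> 'a \<Rightarrow> real) \<Rightarrow> nat \<Rightarrow> nat \<Rightarrow> 'a \<Rightarrow> ereal" where
  "worst_case_from \<U> g T t d =
     (if T < t then 0
      else SUP P \<in> \<U> t d. eexpectation P (\<lambda>d'. ereal (g t d') + worst_case_from \<U> g T (Suc t) d'))"
  by pat_completeness auto
termination
  by (relation "Wellfounded.measure (\<lambda>(\<U>, g, T, t, d). Suc T - t)") auto

declare worst_case_from.simps [simp del]

definition nested_worst_case ::
  "'a measure set \<Rightarrow> (nat \<Rightarrow> 'a \<Rightarrow> 'a measure set) \<Rightarrow> (nat \<Rightarrow> 'a \<Rightarrow> real) \<Rightarrow> nat \<Rightarrow> ereal" where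
  "nested_worst_case \<U>\<^sub>1 \<U> g T =
     (SUP P \<in> \<U>\<^sub>1. eexpectation P (\<lambda>d. ereal (g 1 d) + worst_case_from \<U> g T 2 d))"

definition nested_expectations_exist ::
  "(nat \<Rightarrow> 'a set) \<Rightarrow> 'a measure set \<Rightarrow> (nat \<Rightarrow> 'a \<Rightarrow> 'a measure set) \<Rightarrow> (nat \<Rightarrow> 'a \<Rightarrow> real) \<Rightarrow>
    nat \<Rightarrow> bool" where
  "nested_expectations_exist \<Xi> \<U>\<^sub>1 \<U> g T \<longleftrightarrow>
     (\<forall>P \<in> \<U>\<^sub>1. expectation_exists P (\<lambda>d. ereal (g 1 d) + worst_case_from \<U> g T 2 d)) \<and>
     (\<forall>t \<in> {2..T}. \<forall>d \<in> \<Xi> (t - 1). \<forall>P \<in> \<U> t d.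
        expectation_exists P (\<lambda>d'. ereal (g t d') + worst_case_from \<U> g T (Suc t) d'))"

end

theory Submission
  imports Defs
begin

text \<open>
  Backward induction on the stages, using weak duality at each stage.  If a cost is bounded on the
  support set by the quadratic \<open>p + (q\<^sup>u - q\<^sup>l - 2 R \<mu>\<^sub>0) \<bullet> d + d \<bullet> R d\<close>, then integrating the
  quadratic and completing the square about \<open>\<mu>\<^sub>0\<close> bounds its expectation by
  \<open>p + (q\<^sup>u - q\<^sup>l) \<bullet> \<mu> + (q\<^sup>u + q\<^sup>l) \<bullet> \<delta> + R \<cdot> M\<close>: the mean constraint is paired with \<open>q\<^sup>u, q\<^sup>l\<close> and
  the covariance constraint with \<open>R\<close>, the Frobenius product of two positive semidefinite matrices
  being nonnegative.  As \<open>\<mu>\<close> is affine in the previous realization, this bound is affine in it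
  too, and \<open>\<alpha>, \<beta>\<close> are what is needed to absorb it in the constraint of the previous stage.
\<close>

section \<open>Frobenius products of positive semidefinite matrices\<close>

lemma frobenius_inner_eq_inner: "frobenius_inner R M = R \<bullet> M"
proof -
  have "frobenius_inner R M = (\<Sum>j\<in>UNIV. \<Sum>i\<in>UNIV. R $ i $ j * M $ i $ j)"
    by (simp add: frobenius_inner_def trace_def matrix_matrix_mult_def transpose_def)
  also have "\<dots> = (\<Sum>i\<in>UNIV. \<Sum>j\<in>UNIV. R $ i $ j * M $ i $ j)"
    by (rule sum.swap)
  finally show ?thesis
    by (simp add: inner_vec_def)
qed

lemma outer_prod_nth: "outer_prod v w $ i $ j = v $ i * w $ j"
  by (simp add: outer_prod_def matrix_matrix_mult_def columnvector_def rowvector_def)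

lemma inner_outer_prod: "R \<bullet> outer_prod v w = v \<bullet> (R *v w)"
  by (simp add: inner_vec_def outer_prod_nth matrix_vector_mult_def sum_distrib_left mult_ac)

text \<open>
  Stated for kernels on a finite set rather than for matrices, so that the size can shrink: the
  induction splits off a rank one part, leaving the Schur complement of a diagonal entry.
\<close>

lemma sum_psd_kernels_nonneg:
  fixes r s :: "'a \<Rightarrow> 'a \<Rightarrow> real"
  assumes "finite K"
    and "\<And>i j. r i j = r j i"
    and "\<And>w. 0 \<le> (\<Sum>i\<in>K. \<Sum>j\<in>K. r i j * w i * w j)"
    and "\<And>w. 0 \<le> (\<Sum>i\<in>K. \<Sum>j\<in>K. s i j * w i * w j)"
  shows "0 \<le> (\<Sum>i\<in>K. \<Sum>j\<in>K. r i j * s i j)"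
  using assms
proof (induction K arbitrary: r rule: finite_induct)
  case empty
  then show ?case by simp
next
  case (insert k K)
  note fin = \<open>finite K\<close> and k = \<open>k \<notin> K\<close> and sym = insert.prems(1)
  \<comment> \<open>The value \<open>c\<close> at the new index \<open>k\<close> stays free: below
    it is set to 0 to restrict \<open>s\<close> to \<open>K\<close>, and chosen according to
    \<open>w\<close> to exploit the form of \<open>r\<close>.\<close>
  have upd: "(\<Sum>i\<in>insert k K. \<Sum>j\<in>insert k K. u i j * (w(k := c)) i * (w(k := c)) j) =
      u k k * c\<^sup>2 + c * (\<Sum>j\<in>K. u k j * w j) + c * (\<Sum>i\<in>K. u i k * w i)
        + (\<Sum>i\<in>K. \<Sum>j\<in>K. u i j * w i * w j)"
    for u :: "'a \<Rightarrow> 'a \<Rightarrow> real" and w c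
  proof -
    have *: "(w(k := c)) i = w i" if "i \<in> K" for i
      using that k by auto
    show ?thesis
      using fin k
      by (simp add: * sum.distrib sum_distrib_left power2_eq_square mult_ac
          del: fun_upd_apply cong: sum.cong)
        (simp add: sum.distrib sum_distrib_left mult_ac)
  qed
  have sym_k: "(\<Sum>j\<in>K. r k j * w j) = (\<Sum>j\<in>K. r j k * w j)" for w
    by (intro sum.cong refl) (metis sym)
  have form: "0 \<le> r k k * c\<^sup>2 + 2 * c * (\<Sum>i\<in>K. r i k * w i) + (\<Sum>i\<in>K. \<Sum>j\<in>K. r i j * w i * w j)"
    for w c
    using insert.prems(2)[of "w(k := c)"] unfolding upd by (simp add: sym_k)
  have s_K: "0 \<le> (\<Sum>i\<in>K. \<Sum>j\<in>K. s i j * w i * w j)" for w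
    using insert.prems(3)[of "w(k := 0)"] unfolding upd by simp
  have rkk: "0 \<le> r k k"
    using form[of 1 "\<lambda>_. 0"] by simp
  \<comment> \<open>The Schur complement of \<open>r k k\<close>; its row and column
    \<open>k\<close> vanish when \<open>r k k\<close> is nonzero.\<close>
  define r' where "r' = (\<lambda>i j. r i j - r i k * r j k / r k k)"
  show ?case
  proof (cases "r k k = 0")
    case True
    \<comment> \<open>With a zero diagonal entry the form is affine in \<open>c\<close>, so a
      nonzero slope would make it unbounded below.\<close>
    have zero: "r i k = 0" if i: "i \<in> K" for i
    proof (rule ccontr)
      assume ne: "r i k \<noteq> 0"
      have delta: "(\<Sum>l\<in>K. f l * (if l = i then 1 else 0)) = f i" for f :: "'a \<Rightarrow> real"
        using fin i by (simp add: if_distrib[of "\<lambda>x. f _ * x" for f] sum.delta cong: if_cong)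
      \<comment> \<open>This \<open>c\<close> makes the form equal to -1 at the vector with entry
        \<open>c\<close> at \<open>k\<close>, 1 at \<open>i\<close> and 0 elsewhere.\<close>
      define c where "c = - (1 + r i i) / (2 * r i k)"
      have "0 \<le> 2 * c * r i k + r i i"
        using form[of c "\<lambda>l. if l = i then 1 else 0"] True by (simp add: delta)
      moreover have "2 * c * r i k = - (1 + r i i)"
        using ne by (simp add: c_def)
      ultimately show False by simp
    qed
    have "0 \<le> (\<Sum>i\<in>K. \<Sum>j\<in>K. r i j * s i j)"
      using insert.IH[of r] sym form[of 0] s_K by simp
    then show ?thesis
      using fin k True zero zero[unfolded sym[of _ k]] by simp
  next
    case False
    with rkk have pos: "r k k > 0" by simp
    \<comment> \<open>The entry \<open>- S / r k k\<close> at \<open>k\<close> minimises the form of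
      \<open>r\<close> in that coordinate; the minimum is the form of \<open>r'\<close> at
      \<open>w\<close>.\<close>
    have r'_form: "0 \<le> (\<Sum>i\<in>K. \<Sum>j\<in>K. r' i j * w i * w j)" for w
    proof -
      define S where "S = (\<Sum>i\<in>K. r i k * w i)"
      have "(\<Sum>i\<in>K. \<Sum>j\<in>K. r' i j * w i * w j) =
          (\<Sum>i\<in>K. \<Sum>j\<in>K. r i j * w i * w j) - S\<^sup>2 / r k k"
        by (simp add: r'_def S_def power2_eq_square sum_product sum_divide_distrib
            sum_subtractf algebra_simps)
      moreover have "0 \<le> r k k * (- S / r k k)\<^sup>2 + 2 * (- S / r k k) * S
          + (\<Sum>i\<in>K. \<Sum>j\<in>K. r i j * w i * w j)"
        using form[of "- S / r k k" w] unfolding S_def .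
      moreover have "r k k * (- S / r k k)\<^sup>2 + 2 * (- S / r k k) * S = - (S\<^sup>2 / r k k)"
        using False by (simp add: power2_eq_square field_simps)
      ultimately show ?thesis by simp
    qed
    have IH: "0 \<le> (\<Sum>i\<in>K. \<Sum>j\<in>K. r' i j * s i j)"
      by (rule insert.IH) (use sym r'_form s_K in \<open>auto simp: r'_def mult.commute\<close>)
    have r'k: "r' k j = 0" "r' j k = 0" for j
      using False sym[of k j] by (auto simp: r'_def)
    \<comment> \<open>The rank one part of \<open>r\<close> contributes the form of \<open>s\<close>
      at column \<open>k\<close> of \<open>r\<close>, divided by \<open>r k k\<close>.\<close>
    have "(\<Sum>i\<in>insert k K. \<Sum>j\<in>insert k K. r i j * s i j) =
        (\<Sum>i\<in>insert k K. \<Sum>j\<in>insert k K. r' i j * s i j + (s i j * r i k * r j k) / r k k)"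
      by (intro sum.cong refl) (simp add: r'_def algebra_simps)
    also have "\<dots> = (\<Sum>i\<in>insert k K. \<Sum>j\<in>insert k K. r' i j * s i j)
        + (\<Sum>i\<in>insert k K. \<Sum>j\<in>insert k K. s i j * r i k * r j k) / r k k"
      by (simp only: sum.distrib sum_divide_distrib)
    also have "(\<Sum>i\<in>insert k K. \<Sum>j\<in>insert k K. r' i j * s i j) = (\<Sum>i\<in>K. \<Sum>j\<in>K. r' i j * s i j)"
      using fin k by (simp add: r'k)
    finally show ?thesis
      using IH pos insert.prems(3)[of "\<lambda>i. r i k"] by simp
  qed
qed

lemma psd_inner_psd_nonneg:
  assumes "psd R" "psd S"
  shows "0 \<le> R \<bullet> S"
proof -
  have form: "v \<bullet> (A *v v) = (\<Sum>i\<in>UNIV. \<Sum>j\<in>UNIV. A $ i $ j * v $ i * v $ j)"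
    for A :: "real^'a^'a" and v
    by (simp add: inner_vec_def matrix_vector_mult_def sum_distrib_left mult_ac)
  have nonneg: "0 \<le> (\<Sum>i\<in>UNIV. \<Sum>j\<in>UNIV. A $ i $ j * w i * w j)" if "psd A"
    for A :: "real^'a^'a" and w
  proof -
    have "0 \<le> vec_lambda w \<bullet> (A *v vec_lambda w)"
      using that by (simp add: psd_def)
    then show ?thesis by (simp add: form)
  qed
  have "R $ i $ j = R $ j $ i" for i j
  proof -
    have "transpose R $ i $ j = R $ j $ i"
      by (simp add: transpose_def)
    then show ?thesis
      using assms(1) by (simp add: psd_def)
  qed
  from sum_psd_kernels_nonneg[of UNIV "\<lambda>i j. R $ i $ j" "\<lambda>i j. S $ i $ j", OF _ this]
  show ?thesis
    using assms nonneg by (simp add: inner_vec_def)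
qed

section \<open>Weak duality for a single stage\<close>

text \<open>Passing from \<open>f\<close> to \<open>g\<close> enlarges the positive part and shrinks
  the negative part. Both parts of \<open>g\<close> have finite integrals, so their difference is
  the Bochner integral.\<close>

lemma eexpectation_le_integral:
  assumes int: "integrable P g"
    and le: "AE d in P. f d \<le> ereal (g d)"
  shows "eexpectation P f \<le> ereal (\<integral>d. g d \<partial>P)"
proof -
  let ?a = "\<integral>\<^sup>+ d. ennreal (g d) \<partial>P" and ?b = "\<integral>\<^sup>+ d. ennreal (- g d) \<partial>P"
  have fin: "?a \<noteq> \<infinity>" "?b \<noteq> \<infinity>"
    using int by (auto simp: real_integrable_def)
  have "(\<integral>\<^sup>+ d. e2ennreal (f d) \<partial>P) \<le> ?a"
    by (rule nn_integral_mono_AE, use le in eventually_elim)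
      (use e2ennreal_mono in \<open>fastforce simp: ennreal.abs_eq\<close>)
  moreover have "?b \<le> (\<integral>\<^sup>+ d. e2ennreal (- f d) \<partial>P)"
  proof (rule nn_integral_mono_AE, use le in eventually_elim)
    fix d assume "f d \<le> ereal (g d)"
    then have "ereal (- g d) \<le> - f d"
      by (metis ereal_minus_le_minus uminus_ereal.simps(1))
    then show "ennreal (- g d) \<le> e2ennreal (- f d)"
      by (metis e2ennreal_mono e2ennreal_ereal)
  qed
  ultimately have "eexpectation P f \<le> enn2ereal ?a - enn2ereal ?b"
    unfolding eexpectation_def by (intro ereal_minus_mono) (simp_all add: less_eq_ennreal.rep_eq)
  also have "\<dots> = ereal (enn2real ?a - enn2real ?b)"
    using fin by (cases ?a; cases ?b) (simp_all add: enn2ereal_ennreal)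
  also have "enn2real ?a - enn2real ?b = (\<integral>d. g d \<partial>P)"
    using int by (simp add: real_lebesgue_integral_def)
  finally show ?thesis .
qed

text \<open>Here \<open>f\<close> is extended real because it will be a stage cost plus the
  worst-case value of the later stages, which can be -\<infinity>.\<close>

lemma eexpectation_le_dual_bound:
  fixes \<mu> \<delta> \<mu>\<^sub>0 qu ql :: "real^'m" and \<Sigma> R :: "real^'m^'m"
  assumes P: "P \<in> ambiguity_set \<Xi> \<mu> \<delta> \<mu>\<^sub>0 \<Sigma>"
    and q: "0 \<le> qu" "0 \<le> ql"
    and R: "psd R"
    and le: "\<And>d. d \<in> \<Xi> \<Longrightarrow> f d \<le> ereal (p + (qu - ql - 2 *\<^sub>R (R *v \<mu>\<^sub>0)) \<bullet> d + d \<bullet> (R *v d))"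
  shows "eexpectation P f \<le>
    ereal (p + (qu - ql) \<bullet> \<mu> + (qu + ql) \<bullet> \<delta> + frobenius_inner R (\<Sigma> - outer_prod \<mu>\<^sub>0 \<mu>\<^sub>0))"
proof -
  let ?O = "\<lambda>d. outer_prod (d - \<mu>\<^sub>0) (d - \<mu>\<^sub>0)"
  \<comment> \<open>The quadratic is rewritten in the two moments that \<open>ambiguity_set\<close>
    makes integrable; symmetry of \<open>R\<close> merges the cross terms.\<close>
  define g where "g d = (p - R \<bullet> outer_prod \<mu>\<^sub>0 \<mu>\<^sub>0) + (qu - ql) \<bullet> d + R \<bullet> ?O d" for d
  from P have "prob_space P" and \<Xi>: "emeasure P \<Xi> = 1"
    and int: "integrable P (\<lambda>d. d)" "integrable P ?O"
    and mean: "\<bar>(\<integral>d. d \<partial>P) - \<mu>\<bar> \<le> \<delta>"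
    and cov: "psd (\<Sigma> - (\<integral>d. ?O d \<partial>P))"
    by (auto simp: ambiguity_set_def psd_le_def)
  interpret prob_space P by fact
  have sym: "\<mu>\<^sub>0 \<bullet> (R *v d) = d \<bullet> (R *v \<mu>\<^sub>0)" for d
    using R by (metis dot_lmul_matrix inner_commute psd_def transpose_matrix_vector)
  have g: "g d = p + (qu - ql - 2 *\<^sub>R (R *v \<mu>\<^sub>0)) \<bullet> d + d \<bullet> (R *v d)" for d
    by (simp add: g_def inner_outer_prod inner_diff_left inner_diff_right
        matrix_vector_mult_diff_distrib sym[of d] inner_commute[of "R *v \<mu>\<^sub>0"])
  \<comment> \<open>A non-measurable set has \<open>emeasure\<close> 0, so the value 1 forces
    measurability.\<close>
  have "\<Xi> \<in> sets P"
    using \<Xi> emeasure_notin_sets by force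
  then have "AE d in P. d \<in> \<Xi>"
    using \<Xi> by (simp add: AE_in_set_eq_1 emeasure_eq_measure)
  then have "AE d in P. f d \<le> ereal (g d)"
    by eventually_elim (simp add: g le)
  moreover have "integrable P g"
    unfolding g_def using int by simp
  ultimately have "eexpectation P f \<le> ereal (\<integral>d. g d \<partial>P)"
    by (intro eexpectation_le_integral)
  also have "(\<integral>d. g d \<partial>P) = p - R \<bullet> outer_prod \<mu>\<^sub>0 \<mu>\<^sub>0 + (qu - ql) \<bullet> (\<integral>d. d \<partial>P) + R \<bullet> (\<integral>d. ?O d \<partial>P)"
    unfolding g_def using int by (simp add: prob_space)
  also have "\<dots> \<le> p + (qu - ql) \<bullet> \<mu> + (qu + ql) \<bullet> \<delta> + frobenius_inner R (\<Sigma> - outer_prod \<mu>\<^sub>0 \<mu>\<^sub>0)"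
  proof -
    \<comment> \<open>In each component, \<open>qu\<close> multiplies the upper and
      \<open>ql\<close> the lower half of the mean constraint.\<close>
    have "(qu - ql) \<bullet> ((\<integral>d. d \<partial>P) - \<mu>) \<le> (qu + ql) \<bullet> \<delta>"
      unfolding inner_vec_def
    proof (rule sum_mono)
      fix i
      define y where "y = ((\<integral>d. d \<partial>P) - \<mu>) $ i"
      have "\<bar>y\<bar> \<le> \<delta> $ i"
        using mean by (simp add: less_eq_vec_def abs_vec_def y_def)
      moreover have "0 \<le> qu $ i" "0 \<le> ql $ i"
        using q by (simp_all add: less_eq_vec_def)
      ultimately have "qu $ i * y \<le> qu $ i * \<delta> $ i" "ql $ i * (- y) \<le> ql $ i * \<delta> $ i"
        using mult_left_mono[of y "\<delta> $ i" "qu $ i"] mult_left_mono[of "- y" "\<delta> $ i" "ql $ i"]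
        by linarith+
      then show "(qu - ql) $ i \<bullet> ((\<integral>d. d \<partial>P) - \<mu>) $ i \<le> (qu + ql) $ i \<bullet> \<delta> $ i"
        unfolding y_def[symmetric] by (simp add: algebra_simps)
    qed
    moreover have "0 \<le> R \<bullet> (\<Sigma> - (\<integral>d. ?O d \<partial>P))"
      using R cov by (rule psd_inner_psd_nonneg)
    ultimately show ?thesis
      by (simp add: frobenius_inner_eq_inner inner_diff_right)
  qed
  finally show ?thesis by simp
qed

section \<open>Backward induction over the stages\<close>

theorem theorem5:
  fixes T :: nat
    and n :: "nat \<Rightarrow> nat"
    and x :: "nat \<Rightarrow> real list"
    and h :: "nat \<Rightarrow> real list \<Rightarrow> real^'m \<Rightarrow> real"
    and \<Xi> :: "nat \<Rightarrow> (real^'m) set"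
    and \<mu>\<^sub>1 :: "real^'m"
    and \<mu>0 \<delta> b :: "nat \<Rightarrow> real^'m"
    and \<Sigma> A M :: "nat \<Rightarrow> real^'m^'m"
    and \<U>\<^sub>1 :: "(real^'m) measure set"
    and \<U> :: "nat \<Rightarrow> real^'m \<Rightarrow> (real^'m) measure set"
    and B :: real
    and p :: "nat \<Rightarrow> real"
    and qu ql :: "nat \<Rightarrow> real^'m"
    and R :: "nat \<Rightarrow> real^'m^'m"
    and \<alpha> :: "nat \<Rightarrow> real"
    and \<beta> :: "nat \<Rightarrow> real^'m"
  assumes T: "T \<ge> 2"
    and decisions: "\<And>t. t \<in> {1..T} \<Longrightarrow> length (x t) = n t"
    and U1: "\<U>\<^sub>1 = ambiguity_set (\<Xi> 1) \<mu>\<^sub>1 (\<delta> 1) (\<mu>0 1) (\<Sigma> 1)"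
    and U: "\<And>t d. t \<in> {2..T} \<Longrightarrow>
              \<U> t d = ambiguity_set (\<Xi> t) (A t *v d + b t) (\<delta> t) (\<mu>0 t) (\<Sigma> t)"
    and regular: "nested_expectations_exist \<Xi> \<U>\<^sub>1 \<U> (\<lambda>t. h t (x t)) T"
    and M: "\<And>t. t \<in> {1..T} \<Longrightarrow> M t = \<Sigma> t - outer_prod (\<mu>0 t) (\<mu>0 t)"
    and \<alpha>: "\<And>i. i \<in> {1..T-1} \<Longrightarrow>
              \<alpha> i = p i - p (i+1) - (qu (i+1) - ql (i+1)) \<bullet> b (i+1)
                    - frobenius_inner (R (i+1)) (M (i+1)) - (qu (i+1) + ql (i+1)) \<bullet> \<delta> (i+1)"
    and \<beta>: "\<And>i. i \<in> {1..T-1} \<Longrightarrow>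
              \<beta> i = qu i - ql i - 2 *\<^sub>R (R i *v \<mu>0 i)
                    - transpose (A (i+1)) *v qu (i+1) + transpose (A (i+1)) *v ql (i+1)"
    and symmetric: "\<And>t. t \<in> {1..T} \<Longrightarrow> transpose (R t) = R t"
    and budget: "p 1 + (qu 1 - ql 1) \<bullet> \<mu>\<^sub>1 + (qu 1 + ql 1) \<bullet> \<delta> 1
                   + frobenius_inner (R 1) (M 1) \<le> B"
    and intermediate: "\<And>t d. t \<in> {1..T-1} \<Longrightarrow> d \<in> \<Xi> t \<Longrightarrow>
                         \<alpha> t + \<beta> t \<bullet> d + d \<bullet> (R t *v d) - h t (x t) d \<ge> 0"
    and final: "\<And>d. d \<in> \<Xi> T \<Longrightarrow>
                  p T + (qu T - ql T - 2 *\<^sub>R (R T *v \<mu>0 T)) \<bullet> d + d \<bullet> (R T *v d) \<ge> h T (x T) d"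
    and nonneg: "\<And>t. t \<in> {1..T} \<Longrightarrow> 0 \<le> qu t \<and> 0 \<le> ql t"
    and psd: "\<And>t. t \<in> {1..T} \<Longrightarrow> psd (R t)"
  shows "nested_worst_case \<U>\<^sub>1 \<U> (\<lambda>t. h t (x t)) T \<le> ereal B"
proof -
  let ?g = "\<lambda>t. h t (x t)"
  let ?V = "worst_case_from \<U> ?g T"
  let ?q = "\<lambda>t d. p t + (qu t - ql t - 2 *\<^sub>R (R t *v \<mu>0 t)) \<bullet> d + d \<bullet> (R t *v d)"
  \<comment> \<open>The dual bound of stage \<open>t\<close> as a function of the mean, while
    \<open>?q\<close> is the quadratic majorant that yields it.\<close>
  let ?W = "\<lambda>t \<mu>. p t + (qu t - ql t) \<bullet> \<mu> + (qu t + ql t) \<bullet> \<delta> t + frobenius_inner (R t) (M t)"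
  have cost: "ereal (?g t d) + ?V (Suc t) d \<le> ereal (?q t d)"
    if t: "t \<in> {1..T-1}" and d: "d \<in> \<Xi> t"
      and V: "?V (Suc t) d \<le> ereal (?W (Suc t) (A (Suc t) *v d + b (Suc t)))" for t d
  proof -
    \<comment> \<open>Taking the adjoint of \<open>A (Suc t)\<close> turns the affine bound of the
      next stage into the terms contained in \<alpha> and \<beta>.\<close>
    have "(transpose (A (Suc t)) *v q) \<bullet> d = q \<bullet> (A (Suc t) *v d)" for q
      by (simp add: dot_lmul_matrix transpose_matrix_vector)
    then have "?g t d + ?W (Suc t) (A (Suc t) *v d + b (Suc t)) \<le> ?q t d"
      using intermediate[OF t d] \<alpha>[OF t] \<beta>[OF t]
      by (simp add: inner_diff_left inner_add_left inner_add_right)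
    then have "ereal (?g t d) + ereal (?W (Suc t) (A (Suc t) *v d + b (Suc t))) \<le> ereal (?q t d)"
      by simp
    with add_left_mono[OF V] show ?thesis
      by (rule order_trans)
  qed
  \<comment> \<open>This holds for every \<open>d\<close>, in the support or not, since
    \<open>d\<close> enters only through the mean; the support matters only for the realization
    being integrated.\<close>
  have V: "?V t d \<le> ereal (?W t (A t *v d + b t))" if "t \<le> T" "2 \<le> t" for t d
    using that
  proof (induction t arbitrary: d rule: inc_induct)
    case base
    \<comment> \<open>Beyond the horizon the worst-case value is 0, so \<open>final\<close> itself
      is the majorant.\<close>
    have "eexpectation P (\<lambda>d'. ereal (?g T d') + ?V (Suc T) d') \<le> ereal (?W T (A T *v d + b T))"
      if "P \<in> \<U> T d" for P
      using that T U[of T d] M[of T] nonneg[of T] psd[of T] final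
      by (auto intro!: eexpectation_le_dual_bound simp: worst_case_from.simps[of _ _ _ "Suc T"])
    then show ?case
      by (subst worst_case_from.simps) (auto intro: SUP_least)
  next
    case (step t)
    have "eexpectation P (\<lambda>d'. ereal (?g t d') + ?V (Suc t) d') \<le> ereal (?W t (A t *v d + b t))"
      if "P \<in> \<U> t d" for P
      using that step U[of t d] M[of t] nonneg[of t] psd[of t] cost[of t]
      by (auto intro!: eexpectation_le_dual_bound)
    then show ?case
      using step by (subst worst_case_from.simps) (auto intro: SUP_least)
  qed
  \<comment> \<open>Stage 1 is separate because its mean is the constant
    \<open>\<mu>\<^sub>1\<close>.\<close>
  have "eexpectation P (\<lambda>d. ereal (?g 1 d) + ?V 2 d) \<le> ereal B" if "P \<in> \<U>\<^sub>1" for P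
  proof -
    have "eexpectation P (\<lambda>d. ereal (?g 1 d) + ?V 2 d) \<le> ereal (?W 1 \<mu>\<^sub>1)"
      using that T U1 M[of 1] nonneg[of 1] psd[of 1] cost[of 1] V[of 2]
      by (auto intro!: eexpectation_le_dual_bound simp: numeral_2_eq_2)
    also have "\<dots> \<le> ereal B"
      using budget by simp
    finally show ?thesis .
  qed
  then show ?thesis
    unfolding nested_worst_case_def by (auto intro: SUP_least)
qed

end
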